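(* If there exists an $\mathrm{SRG}(v,k,\lambda,\mu)$ with $v=4k-2\lambda-2\mu$, then there exists an $$\mathrm{SRG}\left(v-1,\ k\tfrac{v-2k}{v-2k-1},\ \tfrac{3k-v}{2}+\tfrac{3k}{2(v-2k-1)},\ \tfrac k2\tfrac{v-2k}{v-2k-1}\right).$$
   Context: Let $I$ be the identity matrix and $J$ the all-ones matrix. A $k$-regular simple graph on $v$ vertices is strongly regular with nonnegative integer parameters $(v,k,\lambda,\mu)$, and is called an $\mathrm{SRG}(v,k,\lambda,\mu)$, if any two neighbors have exactly $\lambda$ common neighbors and any two distinct nonneighbors have exactly $\mu$ common neighbors. Equivalently, its $v\times v$ adjacency matrix $A$ satisfies $A^2=(\lambda-\mu)A+(k-\mu)I+\mu J$.
   Formalization: The graph is assumed nonempty, and when v=2k (exactly the graphs K_{n,n}, where the new λ is −n) the new graph is only claimed to meet the SRG counting conditions, without nonnegativity of its parameters; for v≠2k the claim is as stated. *)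

theory Defs
  imports Complex_Main "Graph_Theory.Pair_Digraph"
begin

(* A finite simple graph is a pair_graph: finite, loop-free, and with a symmetric arc set,
   so that every edge {x, y} is represented by both arcs (x, y) and (y, x). *)

definition nbhd :: "'a pair_pre_digraph \<Rightarrow> 'a \<Rightarrow> 'a set" where
  "nbhd G x = {y. (x, y) \<in> parcs G}"

(* The counting conditions alone, without any sign condition on the parameters. They force
   v > 0 and k >= 0; they also force l >= 0 if G has an edge and m >= 0 if G is not complete.
   For edgeless G the clause for l is vacuous, for complete G the clause for m is. The graph
   without vertices is excluded. *)
definition srg_conditions :: "'a pair_pre_digraph \<Rightarrow> int \<Rightarrow> int \<Rightarrow> int \<Rightarrow> int \<Rightarrow> bool" where
  "srg_conditions G v k l m \<longleftrightarrow>
     pair_graph G \<and> pverts G \<noteq> {} \<and>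
     int (card (pverts G)) = v \<and>
     (\<forall>x\<in>pverts G. int (card (nbhd G x)) = k) \<and>
     (\<forall>x\<in>pverts G. \<forall>y\<in>pverts G. (x, y) \<in> parcs G \<longrightarrow>
        int (card (nbhd G x \<inter> nbhd G y)) = l) \<and>
     (\<forall>x\<in>pverts G. \<forall>y\<in>pverts G. x \<noteq> y \<and> (x, y) \<notin> parcs G \<longrightarrow>
        int (card (nbhd G x \<inter> nbhd G y)) = m)"

definition is_SRG :: "'a pair_pre_digraph \<Rightarrow> int \<Rightarrow> int \<Rightarrow> int \<Rightarrow> int \<Rightarrow> bool" where
  "is_SRG G v k l m \<longleftrightarrow>
     srg_conditions G v k l m \<and> 0 \<le> v \<and> 0 \<le> k \<and> 0 \<le> l \<and> 0 \<le> m"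

end

theory Submission
  imports Defs
begin

text \<open>
  Call a triple of vertices odd if it spans an odd number of edges. The condition
  \<open>v = 4 k - 2 l - 2 m\<close> says exactly that every pair of vertices of \<open>G\<close> lies in the same number
  \<open>K = 2 (k - m)\<close> of odd triples, i.e. that the odd triples form a regular two-graph. Seidel
  switching with respect to the neighbourhood of a vertex \<open>x\<close> preserves the odd triples and
  isolates \<open>x\<close>. In the switched graph the odd triples through \<open>x\<close> and \<open>y\<close> correspond to the
  neighbours of \<open>y\<close>, so the degree is \<open>K\<close>, and the number of odd triples through two further
  vertices then determines the number of their common neighbours. Deleting \<open>x\<close> gives the
  required graph.
\<close>

lemma pair_graph_iff:
  "pair_graph G \<longleftrightarrow>
     finite (pverts G) \<and> parcs G \<subseteq> pverts G \<times> pverts G \<and> sym (parcs G) \<and> irrefl (parcs G)"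
  (is "_ \<longleftrightarrow> ?R")
proof
  assume "pair_graph G"
  then interpret pair_graph G .
  show ?R
    using pair_finite_verts in_arcsD1 in_arcsD2 pair_sym_arcs pair_no_loops
    by (fastforce simp: symmetric_def irrefl_def)
next
  assume R: ?R
  then have "finite (parcs G)"
    by (meson finite_SigmaI finite_subset)
  with R show "pair_graph G"
    by unfold_locales (auto simp: symmetric_def irrefl_def)
qed

lemma nbhd_subset_pverts:
  assumes "pair_graph G"
  shows "nbhd G x \<subseteq> pverts G"
  using assms by (auto simp: pair_graph_iff nbhd_def)

lemma finite_nbhd:
  assumes "pair_graph G"
  shows "finite (nbhd G x)"
  using assms nbhd_subset_pverts[OF assms] by (auto simp: pair_graph_iff intro: finite_subset)

section \<open>Odd triples through a pair of vertices\<close>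

definition odd_triples :: "'a pair_pre_digraph \<Rightarrow> 'a \<Rightarrow> 'a \<Rightarrow> 'a set" where
  "odd_triples G y z =
     {w \<in> pverts G. ((y, z) \<in> parcs G) \<noteq> (((y, w) \<in> parcs G) \<noteq> ((z, w) \<in> parcs G))}"

lemma card_sym_diff:
  assumes "finite A" "finite B"
  shows "int (card ((A - B) \<union> (B - A))) = int (card A) + int (card B) - 2 * int (card (A \<inter> B))"
proof -
  have "card A = card (A - B) + card (A \<inter> B)" "card B = card (B - A) + card (A \<inter> B)"
    using assms by (metis Int_commute card_Diff_subset_Int card_mono finite_Int inf_le1 le_add_diff_inverse2)+
  moreover have "card ((A - B) \<union> (B - A)) = card (A - B) + card (B - A)"
    using assms by (intro card_Un_disjoint) auto
  ultimately show ?thesis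
    by simp
qed

lemma card_odd_triples_nonadjacent:
  assumes G: "pair_graph G" and "(y, z) \<notin> parcs G"
  shows "int (card (odd_triples G y z)) =
    int (card (nbhd G y)) + int (card (nbhd G z)) - 2 * int (card (nbhd G y \<inter> nbhd G z))"
proof -
  have "odd_triples G y z = (nbhd G y - nbhd G z) \<union> (nbhd G z - nbhd G y)"
    using assms by (auto simp: odd_triples_def nbhd_def pair_graph_iff)
  then show ?thesis
    by (simp add: card_sym_diff finite_nbhd[OF G])
qed

text \<open>With the edge present, \<open>w\<close> counts iff it is adjacent to both or to neither
  of \<open>y\<close> and \<open>z\<close>, hence the complement of the symmetric difference. The
  vertices \<open>y\<close> and \<open>z\<close> lie in that difference, so they are not
  counted.\<close>

lemma card_odd_triples_adjacent:
  assumes G: "pair_graph G" and "(y, z) \<in> parcs G"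
  shows "int (card (odd_triples G y z)) = int (card (pverts G))
    - int (card (nbhd G y)) - int (card (nbhd G z)) + 2 * int (card (nbhd G y \<inter> nbhd G z))"
proof -
  let ?D = "(nbhd G y - nbhd G z) \<union> (nbhd G z - nbhd G y)"
  have D: "?D \<subseteq> pverts G"
    using nbhd_subset_pverts[OF G] by blast
  have "odd_triples G y z = pverts G - ?D"
    using assms by (auto simp: odd_triples_def nbhd_def)
  then have "int (card (odd_triples G y z)) = int (card (pverts G)) - int (card ?D)"
    using D G card_mono[OF _ D] finite_subset[OF D]
    by (simp add: card_Diff_subset of_nat_diff pair_graph_iff)
  then show ?thesis
    by (simp add: card_sym_diff finite_nbhd[OF G])
qed

section \<open>Seidel switching and deletion of the isolated vertex\<close>

definition switch_at :: "'a pair_pre_digraph \<Rightarrow> 'a \<Rightarrow> 'a pair_pre_digraph" where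
  "switch_at G x = \<lparr>pverts = pverts G,
     parcs = {(y, z). y \<in> pverts G \<and> z \<in> pverts G \<and>
       ((y, z) \<in> parcs G) \<noteq> (((x, y) \<in> parcs G) \<noteq> ((x, z) \<in> parcs G))}\<rparr>"

lemma pair_graph_switch_at:
  assumes "pair_graph G"
  shows "pair_graph (switch_at G x)"
  using assms by (auto simp: pair_graph_iff switch_at_def sym_def irrefl_def)

lemma nbhd_switch_at_self:
  assumes "pair_graph G"
  shows "nbhd (switch_at G x) x = {}"
  using assms by (auto simp: pair_graph_iff switch_at_def nbhd_def irrefl_def)

text \<open>A pair is toggled iff exactly one of its ends is a neighbour of \<open>x\<close>. Among
  the three pairs of a triple this happens for none or two, so parity survives.\<close>

lemma odd_triples_switch_at:
  assumes "y \<in> pverts G" "z \<in> pverts G"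
  shows "odd_triples (switch_at G x) y z = odd_triples G y z"
  using assms by (auto simp: switch_at_def odd_triples_def)

text \<open>As \<open>x\<close> is isolated, the odd triples through \<open>x\<close> and
  \<open>y\<close> count the neighbours of \<open>y\<close>, so \<open>y\<close> has degree
  \<open>K\<close>. Other pairs then give \<open>K = 2 K - 2 m\<close> if nonadjacent and
  \<open>K = n - 2 K + 2 l\<close> if adjacent, where \<open>n\<close> still counts
  \<open>x\<close>.\<close>

lemma srg_conditions_delete_isolated:
  assumes G: "pair_graph G" and x: "x \<in> pverts G" and isolated: "nbhd G x = {}"
    and reg: "\<And>y z. \<lbrakk>y \<in> pverts G; z \<in> pverts G; y \<noteq> z\<rbrakk> \<Longrightarrow> int (card (odd_triples G y z)) = K"
    and ne: "pverts G \<noteq> {x}"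
    and l: "2 * l = 3 * K - int (card (pverts G))" and m: "2 * m = K"
  shows "srg_conditions (G\<lparr>pverts := pverts G - {x}\<rparr>) (int (card (pverts G)) - 1) K l m"
proof -
  let ?H = "G\<lparr>pverts := pverts G - {x}\<rparr>"
  have notin: "(x, y) \<notin> parcs G" "(y, x) \<notin> parcs G" for y
    using G isolated by (auto simp: nbhd_def pair_graph_iff sym_def)
  have nbhd: "nbhd ?H = nbhd G"
    by (auto simp: nbhd_def)
  \<comment> \<open>No arc meets \<open>x\<close>, so \<open>parcs\<close> can stay as it
    is.\<close>
  have "pair_graph ?H"
    using G notin by (auto simp: pair_graph_iff)
  moreover have "pverts ?H \<noteq> {}"
    using ne x by auto
  moreover have "int (card (pverts ?H)) = int (card (pverts G)) - 1"
    using G x by (simp add: pair_graph_iff of_nat_diff card_gt_0_iff Suc_leI)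
      (metis One_nat_def Suc_leI card_gt_0_iff empty_iff of_nat_1 of_nat_diff)
  moreover have deg: "int (card (nbhd G y)) = K" if "y \<in> pverts G" "y \<noteq> x" for y
    using card_odd_triples_nonadjacent[OF G notin(2), of y] reg[of y x] that x isolated by simp
  moreover have "int (card (nbhd G y \<inter> nbhd G z)) = l"
    if "y \<in> pverts G - {x}" "z \<in> pverts G - {x}" "(y, z) \<in> parcs G" for y z
  proof -
    have "y \<noteq> z"
      using G that by (auto simp: pair_graph_iff irrefl_def)
    then show ?thesis
      using card_odd_triples_adjacent[OF G that(3)] deg[of y] deg[of z] reg[of y z] that l by simp
  qed
  moreover have "int (card (nbhd G y \<inter> nbhd G z)) = m"
    if "y \<in> pverts G - {x}" "z \<in> pverts G - {x}" "y \<noteq> z" "(y, z) \<notin> parcs G" for y z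
    using card_odd_triples_nonadjacent[OF G that(4)] deg[of y] deg[of z] reg[of y z] that m by simp
  ultimately show ?thesis
    unfolding srg_conditions_def nbhd by simp
qed

section \<open>Strongly regular graphs: walks of length two, change of vertex type\<close>

lemma srg_parameter_identity:
  assumes "srg_conditions G v k l m"
  shows "k * (k - l - 1) = (v - k - 1) * m"
proof -
  let ?V = "pverts G"
  from assms have G: "pair_graph G"
    by (simp add: srg_conditions_def)
  then have fin: "finite ?V" and sym: "sym (parcs G)" and irrefl: "irrefl (parcs G)"
    by (auto simp: pair_graph_iff)
  have sub: "nbhd G y \<subseteq> ?V" for y
    by (rule nbhd_subset_pverts[OF G])
  have finN: "finite (nbhd G y)" for y
    by (rule finite_nbhd[OF G])
  have v: "int (card ?V) = v" and deg: "\<And>y. y \<in> ?V \<Longrightarrow> int (card (nbhd G y)) = k"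
    using assms by (auto simp: srg_conditions_def)
  obtain x where x: "x \<in> ?V"
    using assms by (auto simp: srg_conditions_def)
  have xN: "x \<notin> nbhd G x"
    using irrefl by (auto simp: nbhd_def irrefl_def)
  \<comment> \<open>Walks \<open>x, y, z\<close> of length two, counted by their end
    \<open>z\<close>, are regrouped by their middle vertex \<open>y\<close>.\<close>
  have "(\<Sum>z\<in>?V. int (card (nbhd G x \<inter> nbhd G z)))
      = (\<Sum>z\<in>?V. \<Sum>y\<in>nbhd G x. if y \<in> nbhd G z then 1 else 0)"
    by (intro sum.cong) (simp_all add: finN flip: sum.inter_restrict)
  also have "\<dots> = (\<Sum>y\<in>nbhd G x. \<Sum>z\<in>?V. if z \<in> nbhd G y then 1 else 0)"
    using sym by (subst sum.swap) (auto intro!: sum.cong simp: nbhd_def sym_def)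
  also have "\<dots> = (\<Sum>y\<in>nbhd G x. int (card (nbhd G y)))"
    using sub by (intro sum.cong) (simp_all add: fin Int_absorb1 flip: sum.inter_restrict)
  also have "\<dots> = k * k"
    using deg sub x by (simp add: subset_iff)
  finally have kk: "(\<Sum>z\<in>?V. int (card (nbhd G x \<inter> nbhd G z))) = k * k" .
  \<comment> \<open>By end vertex: \<open>z = x\<close> contributes \<open>k\<close>, each neighbour
    \<open>l\<close>, each of the other \<open>v - 1 - k\<close> vertices \<open>m\<close>.\<close>
  have V: "?V = insert x (nbhd G x \<union> (?V - insert x (nbhd G x)))"
    using x sub by auto
  have rest: "int (card (?V - insert x (nbhd G x))) = v - 1 - k"
    using x xN sub fin finN v deg[OF x]
      card_mono[OF fin, of "insert x (nbhd G x)"]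
    by (subst card_Diff_subset) (auto simp: of_nat_diff)
  have "(\<Sum>z\<in>?V. int (card (nbhd G x \<inter> nbhd G z)))
      = int (card (nbhd G x)) + ((\<Sum>z\<in>nbhd G x. int (card (nbhd G x \<inter> nbhd G z)))
        + (\<Sum>z\<in>?V - insert x (nbhd G x). int (card (nbhd G x \<inter> nbhd G z))))"
    using xN fin finN
    by (subst V, subst sum.insert, simp, simp, subst sum.union_disjoint) auto
  also have "(\<Sum>z\<in>nbhd G x. int (card (nbhd G x \<inter> nbhd G z))) = (\<Sum>z\<in>nbhd G x. l)"
    using assms x sub[of x] by (intro sum.cong) (auto simp: srg_conditions_def nbhd_def)
  also have "(\<Sum>z\<in>?V - insert x (nbhd G x). int (card (nbhd G x \<inter> nbhd G z)))
      = (\<Sum>z\<in>?V - insert x (nbhd G x). m)"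
    using assms x by (intro sum.cong) (auto simp: srg_conditions_def nbhd_def)
  finally have "k * k = k + (k * l + (v - 1 - k) * m)"
    using kk deg[OF x] rest by simp
  then show ?thesis
    by (simp add: algebra_simps)
qed

lemma srg_conditions_nat:
  assumes "srg_conditions G v k l m"
  shows "\<exists>H :: nat pair_pre_digraph. srg_conditions H v k l m"
proof -
  from assms have G: "pair_graph G"
    by (simp add: srg_conditions_def)
  then have sub: "nbhd G y \<subseteq> pverts G" for y
    by (rule nbhd_subset_pverts)
  from G obtain h :: "'a \<Rightarrow> nat" where h: "inj_on h (pverts G)"
    using finite_imp_inj_to_nat_seg by (metis pair_graph_iff)
  define g where "g = inv_into (pverts G) h"
  have g: "g (h x) = x" if "x \<in> pverts G" for x
    using h that by (simp add: g_def)
  define H where "H = \<lparr>pverts = h ` pverts G,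
    parcs = {(i, j). i \<in> h ` pverts G \<and> j \<in> h ` pverts G \<and> (g i, g j) \<in> parcs G}\<rparr>"
  have E: "(h x, h y) \<in> parcs H \<longleftrightarrow> (x, y) \<in> parcs G"
    if "x \<in> pverts G" "y \<in> pverts G" for x y
    using that by (simp add: H_def g)
  have "pair_graph H"
    using G by (auto simp: H_def pair_graph_iff sym_def irrefl_def g)
  moreover have N: "nbhd H (h x) = h ` nbhd G x" if "x \<in> pverts G" for x
    using that sub[of x] by (auto simp: H_def nbhd_def g)
  moreover have "card (h ` nbhd G x) = card (nbhd G x)" for x
    using inj_on_subset[OF h sub] by (rule card_image)
  moreover have "card (h ` nbhd G x \<inter> h ` nbhd G y) = card (nbhd G x \<inter> nbhd G y)" for x y
  proof -
    have "h ` nbhd G x \<inter> h ` nbhd G y = h ` (nbhd G x \<inter> nbhd G y)"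
      using inj_on_image_Int[OF h sub sub] by simp
    moreover have "inj_on h (nbhd G x \<inter> nbhd G y)"
      using h sub[of x] by (blast intro: inj_on_subset)
    ultimately show ?thesis
      by (simp add: card_image)
  qed
  moreover have "card (h ` pverts G) = card (pverts G)"
    using h by (rule card_image)
  moreover have "pverts H = h ` pverts G"
    by (simp add: H_def)
  moreover have "h x = h y \<longleftrightarrow> x = y" if "x \<in> pverts G" "y \<in> pverts G" for x y
    using h that by (auto simp: inj_on_def)
  ultimately have "srg_conditions H v k l m"
    using assms E by (simp add: srg_conditions_def)
  then show ?thesis ..
qed

section \<open>The graph obtained from the regular two-graph, and its parameters\<close>

lemma srg_two_graph_descendant:
  assumes srg: "srg_conditions G v k l m" and v: "v = 4 * k - 2 * l - 2 * m"
  shows "\<exists>H :: nat pair_pre_digraph.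
    srg_conditions H (v - 1) (2 * (k - m)) (k + l - 2 * m) (k - m)"
proof -
  from srg have G: "pair_graph G" and card: "int (card (pverts G)) = v"
    by (auto simp: srg_conditions_def)
  from srg obtain x where x: "x \<in> pverts G"
    by (auto simp: srg_conditions_def)
  \<comment> \<open>Parity excludes \<open>v = 1\<close>, where deleting \<open>x\<close> would
    leave no vertex.\<close>
  have "even v"
    using v by simp
  then have ne: "pverts G \<noteq> {x}"
    using card by auto
  \<comment> \<open>Edges give \<open>v - 2 k + 2 l\<close>, non-edges \<open>2 k - 2 m\<close>; the
    hypothesis on \<open>v\<close> equates the two.\<close>
  have reg: "int (card (odd_triples G y z)) = 2 * (k - m)"
    if "y \<in> pverts G" "z \<in> pverts G" "y \<noteq> z" for y z
  proof (cases "(y, z) \<in> parcs G")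
    case True
    then show ?thesis
      using card_odd_triples_adjacent[OF G True] srg that v by (simp add: srg_conditions_def)
  next
    case False
    then show ?thesis
      using card_odd_triples_nonadjacent[OF G False] srg that by (simp add: srg_conditions_def)
  qed
  have pverts: "pverts (switch_at G x) = pverts G"
    by (simp add: switch_at_def)
  have "srg_conditions ((switch_at G x)\<lparr>pverts := pverts (switch_at G x) - {x}\<rparr>)
      (int (card (pverts (switch_at G x))) - 1) (2 * (k - m)) (k + l - 2 * m) (k - m)"
    by (rule srg_conditions_delete_isolated)
      (use x ne v card in \<open>simp_all add: pverts pair_graph_switch_at[OF G] nbhd_switch_at_self[OF G]
        odd_triples_switch_at reg\<close>)
  then show ?thesis
    using srg_conditions_nat card pverts by metis
qed

text \<open>A nonzero degree supplies an edge, whose common neighbours number \<open>l\<close>.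
  There is no such bound for \<open>m\<close>, which is arbitrary for complete graphs.\<close>

lemma srg_conditions_nonneg:
  assumes srg: "srg_conditions G v k l m" and "k \<noteq> 0"
  shows "0 \<le> v" "0 \<le> k" "0 \<le> l"
proof -
  obtain x where x: "x \<in> pverts G"
    using srg by (auto simp: srg_conditions_def)
  then have k: "int (card (nbhd G x)) = k"
    using srg by (simp add: srg_conditions_def)
  with \<open>k \<noteq> 0\<close> obtain y where "y \<in> nbhd G x"
    by fastforce
  moreover from this have "y \<in> pverts G"
    using srg nbhd_subset_pverts by (metis srg_conditions_def subset_iff)
  ultimately have "int (card (nbhd G x \<inter> nbhd G y)) = l"
    using srg x by (simp add: srg_conditions_def nbhd_def)
  then show "0 \<le> l"
    by linarith
  show "0 \<le> k"
    using k by linarith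
  show "0 \<le> v"
    using srg by (auto simp: srg_conditions_def)
qed

(* If v = 2 k then G is the complete bipartite graph K_{k,k}, and the parameters of the
   conclusion are (2 k - 1, 0, -k, 0): they are those of the edgeless graph on 2 k - 1
   vertices, except that the vacuous third parameter is negative. Nonnegativity of the
   parameters is therefore claimed exactly when v \<noteq> 2 k. *)
theorem corollary4p5:
  fixes G :: "'a pair_pre_digraph" and v k l m :: int
  assumes "is_SRG G v k l m"
    and "v = 4 * k - 2 * l - 2 * m"
  shows "\<exists>v' k' l' m' :: int.
      v' = v - 1 \<and>
      real_of_int k' = real_of_int k * (real_of_int (v - 2 * k) / real_of_int (v - 2 * k - 1)) \<and>
      real_of_int l' = real_of_int (3 * k - v) / 2 + real_of_int (3 * k) / real_of_int (2 * (v - 2 * k - 1)) \<and>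
      real_of_int m' = real_of_int k / 2 * (real_of_int (v - 2 * k) / real_of_int (v - 2 * k - 1)) \<and>
      (v \<noteq> 2 * k \<longrightarrow> (\<exists>H :: nat pair_pre_digraph. is_SRG H v' k' l' m')) \<and>
      (v = 2 * k \<longrightarrow> (\<exists>H :: nat pair_pre_digraph. srg_conditions H v' k' l' m'))"
proof -
  from assms have srg: "srg_conditions G v k l m" and nonneg: "0 \<le> k" "0 \<le> l" "0 \<le> m"
    by (auto simp: is_SRG_def)
  have "v > 0"
    using srg by (auto simp: srg_conditions_def card_gt_0_iff pair_graph_iff)
  \<comment> \<open>\<open>k = 0\<close> would give \<open>v = - 2 l - 2 m\<close>, which is not
    positive.\<close>
  then have "k \<noteq> 0"
    using nonneg assms(2) by auto
  define t where "t = v - 2 * k - 1"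
  have "odd t"
    using assms(2) by (simp add: t_def)
  then have t0: "t \<noteq> 0"
    by auto
  have "2 * (k * (k - l - 1)) = 2 * ((v - k - 1) * m)"
    using srg_parameter_identity[OF srg] by simp
  moreover have "2 * l = 4 * k - 2 * m - v"
    using assms(2) by simp
  \<comment> \<open>Eliminating \<open>l\<close> shows that \<open>k / t\<close> is the integer
    \<open>k - 2 m\<close>. With \<open>v - 2 k = t + 1\<close>, this makes all three fractional
    parameters integers.\<close>
  ultimately have tk: "t * (k - 2 * m) = k"
    unfolding t_def using assms(2) by algebra
  have "real_of_int t * real_of_int (k - 2 * m) = real_of_int k"
    using tk by (metis of_int_mult)
  then have frac: "real_of_int k / real_of_int t = real_of_int (k - 2 * m)"
    using t0 by (simp add: field_simps)
  have K: "real_of_int k * (real_of_int (v - 2 * k) / real_of_int t) = 2 * real_of_int (k - m)"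
  proof -
    have "real_of_int k * (real_of_int (v - 2 * k) / real_of_int t)
        = real_of_int k + real_of_int k / real_of_int t"
      using t0 by (simp add: t_def field_simps)
    then show ?thesis
      using frac by simp
  qed
  have L: "real_of_int (3 * k - v) / 2 + real_of_int (3 * k) / real_of_int (2 * t)
      = real_of_int (k + l - 2 * m)"
  proof -
    have "real_of_int (3 * k) / real_of_int (2 * t) = 3 / 2 * (real_of_int k / real_of_int t)"
      by simp
    then show ?thesis
      using frac assms(2) by (simp add: field_simps)
  qed
  obtain H :: "nat pair_pre_digraph"
    where H: "srg_conditions H (v - 1) (2 * (k - m)) (k + l - 2 * m) (k - m)"
    using srg_two_graph_descendant[OF srg assms(2)] by blast
  \<comment> \<open>The new degree vanishes only for \<open>v = 2 k\<close>. Otherwise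
    \<open>H\<close> has an edge, and the fourth parameter is nonnegative as half the
    degree.\<close>
  have "is_SRG H (v - 1) (2 * (k - m)) (k + l - 2 * m) (k - m)" if "v \<noteq> 2 * k"
  proof -
    have "2 * (k - m) * t = t * (k - 2 * m) + k * t"
      by (simp add: algebra_simps)
    also have "\<dots> = k * (v - 2 * k)"
      unfolding tk by (simp add: t_def algebra_simps)
    finally have "2 * (k - m) * t = k * (v - 2 * k)" .
    then have "2 * (k - m) \<noteq> 0"
      using \<open>k \<noteq> 0\<close> that by auto
    then show ?thesis
      using H srg_conditions_nonneg[OF H] by (simp add: is_SRG_def)
  qed
  moreover have "real_of_int k / 2 * (real_of_int (v - 2 * k) / real_of_int t) = real_of_int (k - m)"
    unfolding times_divide_eq_left K by simp
  ultimately show ?thesis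
    unfolding t_def[symmetric] using H K L
    by (intro exI[of _ "v - 1"] exI[of _ "2 * (k - m)"] exI[of _ "k + l - 2 * m"] exI[of _ "k - m"]
        conjI) (blast | simp)+
qed

end
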